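(* Let $m>1$. There exists $\sigma_0>0$ such that for every $\sigma>\sigma_0$ there are no good profiles with interface to the equation $$(f^m)''(\xi)-\frac{1}{m-1}f(\xi)+\xi^{\sigma}f^{m}(\xi)=0,\qquad \xi\in[0,\infty).$$
   Context: A solution (profile) $f$ of the equation on an interval $I\subset[0,\infty)$ is a nonnegative continuous function on $I$ with $f^m\in C^2(I)$ satisfying the equation on $I$. A solution $f$ of the equation is a good profile if it fulfills one of the following two properties: (P1) $f(0)=a>0$ and $f'(0)=0$; (P2) $f(0)=0$ and $(f^m)'(0)=0$. A good profile $f$ is a good profile with interface at some point $\eta\in(0,\infty)$ if $f(\eta)=0$, $(f^m)'(\eta)=0$ and $f>0$ on $(\eta-\delta,\eta)$ for some $\delta>0$. A good profile with interface is a good profile that has an interface at some $\eta\in(0,\infty)$; profiles with interface at $\eta$ which are positive before $\eta$ are understood as extended by $0$ for $\xi>\eta$. *)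

theory Defs
  imports "HOL-Analysis.Analysis"
begin

(* Profiles are total functions on the reals of which only the values on the interval I matter:
   all continuity and derivatives are taken within I, hence one-sided at endpoints of I
   (in particular at 0).  The interval is required to be nondegenerate, since the derivative
   within a single point is not unique. *)

text \<open>\<open>C2_derivs I w w1 w2\<close>: \<open>w\<close> is in \<open>C\<^sup>2(I)\<close>, with first and second derivatives \<open>w1\<close>, \<open>w2\<close>.\<close>

definition C2_derivs ::
  "real set \<Rightarrow> (real \<Rightarrow> real) \<Rightarrow> (real \<Rightarrow> real) \<Rightarrow> (real \<Rightarrow> real) \<Rightarrow> bool" where
  "C2_derivs I w w1 w2 \<longleftrightarrow>
     (\<forall>\<xi>\<in>I. (w has_real_derivative w1 \<xi>) (at \<xi> within I)) \<and>
     (\<forall>\<xi>\<in>I. (w1 has_real_derivative w2 \<xi>) (at \<xi> within I)) \<and>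
     continuous_on I w2"

definition solution_on :: "real \<Rightarrow> real \<Rightarrow> real set \<Rightarrow> (real \<Rightarrow> real) \<Rightarrow> bool" where
  "solution_on m \<sigma> I f \<longleftrightarrow>
     is_interval I \<and> interior I \<noteq> {} \<and> I \<subseteq> {0..} \<and>
     (\<forall>\<xi>\<in>I. 0 \<le> f \<xi>) \<and> continuous_on I f \<and>
     (\<exists>w1 w2. C2_derivs I (\<lambda>\<xi>. f \<xi> powr m) w1 w2 \<and>
        (\<forall>\<xi>\<in>I. w2 \<xi> - 1 / (m - 1) * f \<xi> + \<xi> powr \<sigma> * f \<xi> powr m = 0))"

definition good_profile :: "real \<Rightarrow> real \<Rightarrow> real set \<Rightarrow> (real \<Rightarrow> real) \<Rightarrow> bool" where
  "good_profile m \<sigma> I f \<longleftrightarrow>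
     solution_on m \<sigma> I f \<and> 0 \<in> I \<and>
     (f 0 > 0 \<and> (f has_real_derivative 0) (at 0 within I) \<or>
      f 0 = 0 \<and> ((\<lambda>\<xi>. f \<xi> powr m) has_real_derivative 0) (at 0 within I))"

definition interface_at :: "real \<Rightarrow> real set \<Rightarrow> (real \<Rightarrow> real) \<Rightarrow> real \<Rightarrow> bool" where
  "interface_at m I f \<eta> \<longleftrightarrow>
     0 < \<eta> \<and> \<eta> \<in> I \<and> f \<eta> = 0 \<and>
     ((\<lambda>\<xi>. f \<xi> powr m) has_real_derivative 0) (at \<eta> within I) \<and>
     (\<exists>\<delta>>0. {\<eta> - \<delta><..<\<eta>} \<subseteq> I \<and> (\<forall>\<xi>\<in>{\<eta> - \<delta><..<\<eta>}. f \<xi> > 0))"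

(* I is arbitrary: this covers profiles on the whole half-line as well as profiles that are only
   given up to the interface, I = {0..\<eta>}; the latter extend by 0 to a solution on {0..}. *)
definition good_profile_with_interface ::
  "real \<Rightarrow> real \<Rightarrow> real set \<Rightarrow> (real \<Rightarrow> real) \<Rightarrow> bool" where
  "good_profile_with_interface m \<sigma> I f \<longleftrightarrow>
     good_profile m \<sigma> I f \<and> (\<exists>\<eta>. interface_at m I f \<eta>)"

end

theory Submission
  imports Defs
begin

text \<open>
  Put \<open>w = f\<^sup>m\<close>, \<open>p = 1/m\<close>, \<open>c = 1/(m - 1)\<close>, so that \<open>w'' = c w\<^sup>p - \<xi>\<^sup>\<sigma> w\<close>, and let
  \<open>E = w'\<^sup>2/2 - c w\<^bsup>p+1\<^esup>/(p+1) + \<xi>\<^sup>\<sigma> w\<^sup>2/2\<close> be the energy. With \<open>\<alpha> = 1/(p+1) = m/(m+1)\<close>,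
  the terms in \<open>w\<^bsup>p+1\<^esup>\<close> cancel in the derivative of the Pohozaev functional
  \<open>G = \<xi> E + \<alpha> w w'\<close>:
  \<open>G' = (1/2 + \<alpha>) w'\<^sup>2 + ((1 + \<sigma>)/2 - \<alpha>) \<xi>\<^sup>\<sigma> w\<^sup>2\<close>.
  As \<open>\<alpha> < 1\<close>, for \<open>\<sigma> \<ge> 1\<close> this is nonnegative, and positive wherever \<open>w > 0\<close>.
  But \<open>G\<close> vanishes at \<open>0\<close>, since \<open>w'(0) = 0\<close> for a good profile, and at an interface.
  So \<open>\<sigma>\<^sub>0 = 1\<close> works for every \<open>m\<close>.
\<close>

text \<open>Needed up to the boundary, because both \<xi> and w may be 0. There the one-sided
  difference quotient is \<open>y powr (q - 1)\<close>, which tends to 0 as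
  \<open>q > 1\<close>.\<close>

lemma has_real_derivative_powr_within_nonneg:
  fixes q x :: real
  assumes "q > 1" "x \<ge> 0"
  shows "((\<lambda>x. x powr q) has_real_derivative q * x powr (q - 1)) (at x within {0..})"
proof (cases "x = 0")
  case True
  have "((\<lambda>y::real. y powr (q - 1)) \<longlongrightarrow> 0 powr (q - 1)) (at 0 within {0..})"
    using \<open>q > 1\<close> by (intro tendsto_powr' tendsto_intros) (auto simp: eventually_at_filter)
  then have "((\<lambda>y::real. y powr (q - 1)) \<longlongrightarrow> 0) (at 0 within {0..})"
    by simp
  then have "((\<lambda>y::real. (y powr q - 0 powr q) / (y - 0)) \<longlongrightarrow> 0) (at 0 within {0..})"
    by (rule Lim_transform_within[where d = 1]) (auto simp: powr_diff)
  then show ?thesis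
    using True by (simp add: has_field_derivative_iff)
next
  case False
  then show ?thesis
    using assms has_real_derivative_powr[of x q] has_field_derivative_at_within by simp
qed

text \<open>Chain rule relative to the image of \<open>S\<close>, which lies in the half-line
  \<open>{0..}\<close>; so \<open>g\<close> may vanish at \<open>x\<close>.\<close>

lemma has_real_derivative_powr_compose_nonneg:
  fixes q :: real
  assumes g: "(g has_real_derivative d) (at x within S)"
    and nonneg: "\<And>y. y \<in> S \<Longrightarrow> g y \<ge> 0" and "q > 1" "x \<in> S"
  shows "((\<lambda>y. g y powr q) has_real_derivative q * g x powr (q - 1) * d) (at x within S)"
proof -
  have "((\<lambda>y. y powr q) has_real_derivative q * g x powr (q - 1)) (at (g x) within g ` S)"
    using has_real_derivative_powr_within_nonneg[of q "g x"] nonneg assms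
    by (auto intro: DERIV_subset)
  from DERIV_image_chain[OF this g] show ?thesis
    by (simp add: o_def)
qed

text \<open>The factor \<open>m / (m + 1) / (m - 1)\<close> is c/(p+1), since p + 1 = (m +
  1)/m.\<close>

definition energy :: "real \<Rightarrow> real \<Rightarrow> (real \<Rightarrow> real) \<Rightarrow> (real \<Rightarrow> real) \<Rightarrow> real \<Rightarrow> real" where
  "energy m \<sigma> w w1 \<xi> =
     (w1 \<xi>)\<^sup>2 / 2 - m / (m + 1) / (m - 1) * w \<xi> powr (1 + 1 / m) + \<xi> powr \<sigma> * (w \<xi>)\<^sup>2 / 2"

definition pohozaev :: "real \<Rightarrow> real \<Rightarrow> (real \<Rightarrow> real) \<Rightarrow> (real \<Rightarrow> real) \<Rightarrow> real \<Rightarrow> real" where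
  "pohozaev m \<sigma> w w1 \<xi> = \<xi> * energy m \<sigma> w w1 \<xi> + m / (m + 1) * (w \<xi> * w1 \<xi>)"

text \<open>By the equation, all terms containing w' cancel; what remains comes from the explicit
  dependence of the potential on \<xi>.\<close>

lemma energy_has_derivative:
  assumes "m > 1" "\<sigma> > 1" "x \<in> S" "S \<subseteq> {0..}" "\<And>y. y \<in> S \<Longrightarrow> w y \<ge> 0"
    and w: "(w has_real_derivative w1 x) (at x within S)"
    and w1: "(w1 has_real_derivative w2) (at x within S)"
    and eq: "w2 = 1 / (m - 1) * w x powr (1 / m) - x powr \<sigma> * w x"
  shows "(energy m \<sigma> w w1 has_real_derivative \<sigma> * x powr (\<sigma> - 1) * (w x)\<^sup>2 / 2) (at x within S)"
proof -
  have F: "((\<lambda>y. w y powr (1 + 1 / m)) has_real_derivative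
      (1 + 1 / m) * w x powr (1 / m) * w1 x) (at x within S)"
    using has_real_derivative_powr_compose_nonneg[OF w, of "1 + 1 / m"] assms by simp
  have X: "((\<lambda>y. y powr \<sigma>) has_real_derivative \<sigma> * x powr (\<sigma> - 1)) (at x within S)"
    using has_real_derivative_powr_within_nonneg[of \<sigma> x] assms by (auto intro: DERIV_subset)
  have coeff: "m / (m + 1) / (m - 1) * ((1 + 1 / m) * z) = 1 / (m - 1) * z" for z
    using \<open>m > 1\<close> by (simp add: divide_simps)
  have "(energy m \<sigma> w w1 has_real_derivative
      w1 x * w2 - m / (m + 1) / (m - 1) * ((1 + 1 / m) * (w x powr (1 / m) * w1 x))
      + (\<sigma> * x powr (\<sigma> - 1) * (w x)\<^sup>2 / 2 + x powr \<sigma> * (w x * w1 x))) (at x within S)"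
    unfolding energy_def[abs_def]
    by (rule DERIV_cong[OF DERIV_add[OF
      DERIV_diff[OF DERIV_cdivide[OF DERIV_power[OF w1, where n = 2]] DERIV_cmult[OF F]]
      DERIV_cdivide[OF DERIV_mult[OF X DERIV_power[OF w, where n = 2]]]]])
      (simp add: algebra_simps add_divide_distrib)
  then show ?thesis
    unfolding coeff eq by (simp add: algebra_simps)
qed

lemma pohozaev_has_derivative:
  assumes "m > 1" "\<sigma> > 1" "x \<in> S" "S \<subseteq> {0..}" "\<And>y. y \<in> S \<Longrightarrow> w y \<ge> 0"
    and w: "(w has_real_derivative w1 x) (at x within S)"
    and w1: "(w1 has_real_derivative w2) (at x within S)"
    and eq: "w2 = 1 / (m - 1) * w x powr (1 / m) - x powr \<sigma> * w x"
  shows "(pohozaev m \<sigma> w w1 has_real_derivative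
    (1 / 2 + m / (m + 1)) * (w1 x)\<^sup>2 + ((1 + \<sigma>) / 2 - m / (m + 1)) * x powr \<sigma> * (w x)\<^sup>2)
    (at x within S)"
proof -
  have "x \<ge> 0" "w x \<ge> 0"
    using assms by auto
  \<comment> \<open>Since \<open>0 powr a = 0\<close> for every \<open>a\<close>, this identity and
    the next one persist at \<open>x = 0\<close> and at zeros of \<open>w\<close>.\<close>
  have x: "x * x powr (\<sigma> - 1) = x powr \<sigma>"
    using \<open>x \<ge> 0\<close> by (cases "x = 0") (auto simp: powr_diff)
  have p: "w x * w x powr (1 / m) = w x powr (1 + 1 / m)"
    using \<open>w x \<ge> 0\<close> by (cases "w x = 0") (auto simp: powr_add)
  have "(pohozaev m \<sigma> w w1 has_real_derivative
      energy m \<sigma> w w1 x + x * (\<sigma> * x powr (\<sigma> - 1) * (w x)\<^sup>2 / 2)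
      + m / (m + 1) * (w1 x * w1 x + w x * w2)) (at x within S)"
    unfolding pohozaev_def[abs_def]
    by (rule DERIV_cong[OF DERIV_add[OF DERIV_mult[OF DERIV_ident energy_has_derivative[OF assms]]
      DERIV_cmult[OF DERIV_mult[OF w w1]]]]) (simp_all add: algebra_simps)
  also have "x * (\<sigma> * x powr (\<sigma> - 1) * (w x)\<^sup>2 / 2) = \<sigma> / 2 * x powr \<sigma> * (w x)\<^sup>2"
    by (simp add: x[symmetric])
  also have "w x * w2 = 1 / (m - 1) * w x powr (1 + 1 / m) - x powr \<sigma> * (w x)\<^sup>2"
    by (simp add: eq p[symmetric] algebra_simps power2_eq_square)
  finally show ?thesis
    by (rule DERIV_cong) (simp add: energy_def algebra_simps power2_eq_square add_divide_distrib)
qed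

text \<open>Treats (P1) and (P2) alike: under (P1) the chain rule gives (f^m)' = m f^(m-1) f' = 0 at
  the origin.\<close>

lemma good_profile_deriv_0:
  assumes "m > 1" "good_profile m \<sigma> I f"
  shows "((\<lambda>\<xi>. f \<xi> powr m) has_real_derivative 0) (at 0 within I)"
proof (cases "f 0 > 0")
  case True
  then have "(f has_real_derivative 0) (at 0 within I)" "\<And>y. y \<in> I \<Longrightarrow> f y \<ge> 0" "0 \<in> I"
    using assms by (auto simp: good_profile_def solution_on_def)
  then show ?thesis
    using has_real_derivative_powr_compose_nonneg[of f 0 0 I m] \<open>m > 1\<close> by simp
next
  case False
  then show ?thesis
    using assms by (auto simp: good_profile_def)
qed

lemma no_good_profile_with_interface:
  assumes "m > 1" "\<sigma> > 1"
  shows "\<not> good_profile_with_interface m \<sigma> I f"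
proof
  assume "good_profile_with_interface m \<sigma> I f"
  then obtain \<eta> where good: "good_profile m \<sigma> I f" and int: "interface_at m I f \<eta>"
    by (auto simp: good_profile_with_interface_def)
  define w where "w = (\<lambda>\<xi>. f \<xi> powr m)"
  from good have sol: "solution_on m \<sigma> I f" and "0 \<in> I"
    by (auto simp: good_profile_def)
  then obtain w1 w2 where C2: "C2_derivs I w w1 w2"
    and ode: "\<And>\<xi>. \<xi> \<in> I \<Longrightarrow> w2 \<xi> - 1 / (m - 1) * f \<xi> + \<xi> powr \<sigma> * f \<xi> powr m = 0"
    and "is_interval I" and nonneg: "\<And>\<xi>. \<xi> \<in> I \<Longrightarrow> f \<xi> \<ge> 0"
    unfolding solution_on_def w_def by blast
  from int obtain \<delta> where "\<eta> > 0" "\<eta> \<in> I" "f \<eta> = 0" "\<delta> > 0"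
    and d\<eta>: "(w has_real_derivative 0) (at \<eta> within I)"
    and pos: "\<And>\<xi>. \<eta> - \<delta> < \<xi> \<Longrightarrow> \<xi> < \<eta> \<Longrightarrow> f \<xi> > 0"
    by (auto simp: interface_at_def w_def)
  have sub: "{0..\<eta>} \<subseteq> I"
    using mem_is_interval_1_I[OF \<open>is_interval I\<close> \<open>0 \<in> I\<close> \<open>\<eta> \<in> I\<close>] by auto
  have w': "(w has_real_derivative w1 x) (at x within {0..\<eta>})"
    and w1': "(w1 has_real_derivative w2 x) (at x within {0..\<eta>})" if "x \<in> {0..\<eta>}" for x
    using C2 sub that DERIV_subset[OF _ sub]
    unfolding C2_derivs_def by blast+
  have eq: "w2 x = 1 / (m - 1) * w x powr (1 / m) - x powr \<sigma> * w x" if "x \<in> {0..\<eta>}" for x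
    using ode[of x] nonneg[of x] sub that \<open>m > 1\<close> by (auto simp: w_def powr_powr)
  \<comment> \<open>Transfers the boundary conditions on f^m to the witness \<open>w1\<close>:
    derivatives within the nondegenerate interval \<open>{0..\<eta>}\<close> are unique, also at its
    endpoints.\<close>
  have deriv_unique: "w1 x = 0"
    if "x \<in> {0..\<eta>}" "(w has_real_derivative 0) (at x within I)" for x
    using vector_derivative_unique_within_closed_interval[of 0 \<eta> x w "w1 x" 0]
      w'[OF that(1)] DERIV_subset[OF that(2) sub] that(1) \<open>\<eta> > 0\<close>
    by (simp add: has_real_derivative_iff_has_vector_derivative cbox_interval)
  have "w1 0 = 0" "w1 \<eta> = 0"
    using deriv_unique good_profile_deriv_0[OF \<open>m > 1\<close> good] d\<eta> \<open>\<eta> > 0\<close> by (auto simp: w_def)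
  define G where "G = pohozaev m \<sigma> w w1"
  define G' where "G' = (\<lambda>x. (1 / 2 + m / (m + 1)) * (w1 x)\<^sup>2
      + ((1 + \<sigma>) / 2 - m / (m + 1)) * x powr \<sigma> * (w x)\<^sup>2)"
  have G: "(G has_real_derivative G' x) (at x within {0..\<eta>})" if "x \<in> {0..\<eta>}" for x
    unfolding G_def G'_def
    by (rule pohozaev_has_derivative[OF assms that _ _ w'[OF that] w1'[OF that] eq[OF that]])
      (auto simp: w_def)
  have cont: "continuous_on {0..\<eta>} G"
    by (rule DERIV_continuous_on[OF G])
  have G_at: "DERIV G x :> G' x" if "0 < x" "x < \<eta>" for x
    using G[of x] that by (simp add: at_within_Icc_at)
  have "m / (m + 1) < 1"
    using \<open>m > 1\<close> by simp
  also have "1 < (1 + \<sigma>) / 2"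
    using \<open>\<sigma> > 1\<close> by simp
  finally have coeffs: "(1 + \<sigma>) / 2 - m / (m + 1) > 0"
    by (simp only: diff_gt_0_iff_gt)
  have coeffs': "1 / 2 + m / (m + 1) \<ge> 0"
    using \<open>m > 1\<close> by (intro add_nonneg_nonneg) auto
  have G'_nonneg: "G' x \<ge> 0" for x
    unfolding G'_def
    by (intro add_nonneg_nonneg[OF mult_nonneg_nonneg[OF coeffs'] mult_nonneg_nonneg]
        mult_nonneg_nonneg[OF less_imp_le[OF coeffs]]) auto
  have G'_pos: "G' x > 0" if "0 < x" "w x > 0" for x
    using that unfolding G'_def
    by (intro add_nonneg_pos[OF mult_nonneg_nonneg[OF coeffs'] mult_pos_pos]
        mult_pos_pos[OF coeffs]) auto
  \<comment> \<open>Positivity of f is known only on (\<eta> - \<delta>, \<eta>), and \<delta> may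
    exceed \<eta>. Before \<open>s\<close>, f may vanish, so \<open>G\<close> is only shown to be
    nondecreasing there; the strict increase comes from (s, \<eta>).\<close>
  define s where "s = max 0 (\<eta> - \<delta>)"
  have s: "0 \<le> s" "s < \<eta>" "\<eta> - \<delta> \<le> s"
    using \<open>\<eta> > 0\<close> \<open>\<delta> > 0\<close> by (auto simp: s_def)
  have "G 0 \<le> G s"
  proof (rule DERIV_nonneg_imp_increasing_open[OF \<open>0 \<le> s\<close>])
    show "\<exists>y. DERIV G x :> y \<and> y \<ge> 0" if "0 < x" "x < s" for x
      using G_at[of x] G'_nonneg that s by auto
    show "continuous_on {0..s} G"
      using cont s by (auto intro: continuous_on_subset)
  qed
  also have "G s < G \<eta>"
  proof (rule DERIV_pos_imp_increasing_open[OF \<open>s < \<eta>\<close>])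
    show "\<exists>y. DERIV G x :> y \<and> y > 0" if "s < x" "x < \<eta>" for x
      using G_at[of x] G'_pos[of x] pos[of x] that s by (auto simp: w_def)
    show "continuous_on {s..\<eta>} G"
      using cont s by (auto intro: continuous_on_subset)
  qed
  finally have "G 0 < G \<eta>" .
  \<comment> \<open>At 0 the factor \<xi> removes the energy, whatever f(0) is, and w'(0) = 0
    removes the other term; at \<eta> both w and w' vanish.\<close>
  moreover have "G 0 = 0" "G \<eta> = 0"
    using \<open>w1 0 = 0\<close> \<open>w1 \<eta> = 0\<close> \<open>f \<eta> = 0\<close> by (auto simp: G_def pohozaev_def energy_def w_def)
  ultimately show False
    by simp
qed

theorem theorem1p3:
  fixes m :: real
  assumes "m > 1"
  shows "\<exists>\<sigma>\<^sub>0>0. \<forall>\<sigma>>\<sigma>\<^sub>0. \<not> (\<exists>I f. good_profile_with_interface m \<sigma> I f)"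
  using no_good_profile_with_interface[OF assms] by (intro exI[of _ 1]) auto

end
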